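(* $\Phi(\mathfrak{c})$ is equivalent to Jensen's principle $\diamondsuit$, where $\mathfrak{c}$ denotes the invariant $(\mathbb{R},\mathbb{R},=)$.
   Context: For sets $A,B$ and a relation $E\subseteq A\times B$, $\Phi(A,B,E)$ is the statement: for every $F:2^{<\omega_1}\to A$ there is $g:\omega_1\to B$ such that for every $f:\omega_1\to 2$ the set $\{\alpha\in\omega_1: F(f\restriction\alpha)\,E\,g(\alpha)\}$ is stationary in $\omega_1$. Here $2^{<\omega_1}$ is the set of all functions from a countable ordinal into $2=\{0,1\}$. Thus $\Phi(\mathfrak{c})$ is $\Phi(\mathbb{R},\mathbb{R},=)$. $\diamondsuit$ is the statement: there is a sequence $A_\alpha$ ($\alpha<\omega_1$) with $A_\alpha\subseteq\alpha$ such that for every $X\subseteq\omega_1$ the set $\{\alpha<\omega_1: X\cap\alpha=A_\alpha\}$ is stationary. *)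

theory Defs
  imports "HOL-Library.Countable_Set" "HOL-Library.FuncSet" Complex_Main
begin

text \<open>
  The ordinal \<open>\<omega>\<^sub>1\<close> is the canonical well-order of type \<open>cardSuc natLeq\<close>, the cardinal successor
  of \<open>\<aleph>\<^sub>0\<close>. Its elements are the ordinals below \<open>\<omega>\<^sub>1\<close>; the ordinal \<open>\<alpha>\<close>, as the set of its
  predecessors, is \<open>{..<\<alpha>}\<close>.
\<close>

typedef omega1 = "Field (cardSuc natLeq)"
proof -
  have "Field (cardSuc natLeq) \<noteq> {}"
    by (metis Field_natLeq cardSuc_finite finite.emptyI infinite_UNIV_nat natLeq_Card_order)
  then show ?thesis by blast
qed

lemma Well_order_cardSuc_natLeq: "Well_order (cardSuc natLeq)"
  using cardSuc_Card_order[OF natLeq_Card_order] by (rule card_order_on_well_order_on)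

instantiation omega1 :: wellorder
begin

definition less_eq_omega1 :: "omega1 \<Rightarrow> omega1 \<Rightarrow> bool" where
  "\<alpha> \<le> \<beta> \<longleftrightarrow> (Rep_omega1 \<alpha>, Rep_omega1 \<beta>) \<in> cardSuc natLeq"

definition less_omega1 :: "omega1 \<Rightarrow> omega1 \<Rightarrow> bool" where
  "\<alpha> < \<beta> \<longleftrightarrow> \<alpha> \<le> \<beta> \<and> \<alpha> \<noteq> (\<beta>::omega1)"

instance
proof -
  let ?r = "cardSuc natLeq"
  note wo = Well_order_cardSuc_natLeq
  have refl: "refl_on (Field ?r) ?r" and tr: "trans ?r" and as: "antisym ?r"
    and tot: "total_on (Field ?r) ?r" and wf: "wf (?r - Id)"
    using wo by (auto simp: well_order_on_def linear_order_on_def partial_order_on_def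
        preorder_on_def)
  have le_refl: "x \<le> x" for x :: omega1
    using refl Rep_omega1[of x] by (auto simp: less_eq_omega1_def dest: refl_onD)
  have le_trans: "x \<le> y \<Longrightarrow> y \<le> z \<Longrightarrow> x \<le> z" for x y z :: omega1
    using tr by (auto simp: less_eq_omega1_def dest: transD)
  have le_antisym: "x \<le> y \<Longrightarrow> y \<le> x \<Longrightarrow> x = y" for x y :: omega1
    using as by (auto simp: less_eq_omega1_def Rep_omega1_inject[symmetric] dest: antisymD)
  have le_total: "x \<le> y \<or> y \<le> x" for x y :: omega1
    using tot Rep_omega1[of x] Rep_omega1[of y] le_refl
    by (cases "x = y") (auto simp: less_eq_omega1_def total_on_def Rep_omega1_inject)
  have wf': "wf {(x, y). x < (y::omega1)}"
    by (rule wf_subset[OF wf_inv_image[OF wf, of Rep_omega1]])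
       (auto simp: less_omega1_def less_eq_omega1_def Rep_omega1_inject)
  have induct: "P a" if "\<And>x. (\<And>y. y < x \<Longrightarrow> P y) \<Longrightarrow> P x" for P and a :: omega1
    using wf_induct[OF wf', of P a] that by blast
  show "OFCLASS(omega1, wellorder_class)"
  proof intro_classes
    fix P :: "omega1 \<Rightarrow> bool" and a
    assume "\<And>x. (\<And>y. y < x \<Longrightarrow> P y) \<Longrightarrow> P x"
    then show "P a" by (rule induct)
  qed (use le_refl le_trans le_antisym le_total in \<open>auto simp: less_omega1_def\<close>)
qed

end

lemma countable_lessThan_omega1:
  includes cardinal_syntax
  shows "countable {..<\<alpha>::omega1}"
proof -
  let ?r = "cardSuc natLeq"
  have "|underS ?r (Rep_omega1 \<alpha>)| <o ?r"
    by (rule card_of_underS[OF cardSuc_Card_order[OF natLeq_Card_order] Rep_omega1])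
  then have "|underS ?r (Rep_omega1 \<alpha>)| \<le>o natLeq"
    using cardSuc_ordLeq_ordLess[OF natLeq_Card_order card_of_Card_order] by blast
  then have "|underS ?r (Rep_omega1 \<alpha>)| \<le>o |UNIV::nat set|"
    using card_of_nat ordIso_symmetric ordLeq_ordIso_trans by blast
  then have "countable (underS ?r (Rep_omega1 \<alpha>))"
    by (auto simp: countable_def card_of_ordLeq[symmetric])
  moreover have "Rep_omega1 ` {..<\<alpha>} \<subseteq> underS ?r (Rep_omega1 \<alpha>)"
    by (auto simp: underS_def less_omega1_def less_eq_omega1_def Rep_omega1_inject)
  ultimately have "countable (Rep_omega1 ` {..<\<alpha>})"
    by (rule countable_subset[rotated])
  then show ?thesis
    by (rule countable_image_inj_on) (auto simp: inj_on_def Rep_omega1_inject)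
qed

lemma uncountable_UNIV_omega1:
  includes cardinal_syntax
  shows "uncountable (UNIV::omega1 set)"
proof
  let ?r = "cardSuc natLeq"
  assume "countable (UNIV::omega1 set)"
  then have "countable (range Rep_omega1)" by (rule countable_image)
  then have "countable (Field ?r)"
    by (simp add: type_definition.Rep_range[OF type_definition_omega1])
  then have "|Field ?r| \<le>o |UNIV::nat set|"
    by (auto simp: countable_def card_of_ordLeq[symmetric])
  then have "|Field ?r| \<le>o natLeq"
    using card_of_nat ordLeq_ordIso_trans by blast
  then have "?r \<le>o natLeq"
    using card_of_Field_ordIso[OF cardSuc_Card_order[OF natLeq_Card_order]]
      ordIso_symmetric ordIso_ordLeq_trans by blast
  then show False
    using cardSuc_greater[OF natLeq_Card_order] not_ordLess_ordLeq by blast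
qed

definition unbounded_omega1 :: "omega1 set \<Rightarrow> bool" where
  "unbounded_omega1 C \<longleftrightarrow> (\<forall>\<beta>. \<exists>\<gamma>\<in>C. \<beta> < \<gamma>)"

text \<open>
  A nonzero \<open>\<delta>\<close> in which \<open>C \<inter> \<delta>\<close> is unbounded is automatically a limit ordinal, so the
  following only constrains limit ordinals.
\<close>

definition closed_omega1 :: "omega1 set \<Rightarrow> bool" where
  "closed_omega1 C \<longleftrightarrow>
    (\<forall>\<delta>. {..<\<delta>} \<noteq> {} \<and> (\<forall>\<beta><\<delta>. \<exists>\<gamma>\<in>C. \<beta> < \<gamma> \<and> \<gamma> < \<delta>) \<longrightarrow> \<delta> \<in> C)"

definition club_omega1 :: "omega1 set \<Rightarrow> bool" where
  "club_omega1 C \<longleftrightarrow> closed_omega1 C \<and> unbounded_omega1 C"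

definition stationary :: "omega1 set \<Rightarrow> bool" where
  "stationary S \<longleftrightarrow> (\<forall>C. club_omega1 C \<longrightarrow> S \<inter> C \<noteq> {})"

text \<open>
  A function from a countable ordinal \<open>\<alpha>\<close> into \<open>2\<close> is a partial map with domain \<open>{..<\<alpha>}\<close>;
  \<open>2\<close> is represented by \<^typ>\<open>bool\<close>.
\<close>

definition bin_seqs :: "(omega1 \<rightharpoonup> bool) set" where
  "bin_seqs = {s. \<exists>\<alpha>. dom s = {..<\<alpha>}}"

definition restr :: "(omega1 \<Rightarrow> bool) \<Rightarrow> omega1 \<Rightarrow> (omega1 \<rightharpoonup> bool)" where
  "restr f \<alpha> = (Some \<circ> f) |` {..<\<alpha>}"

lemma restr_in_bin_seqs: "restr f \<alpha> \<in> bin_seqs"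
  by (auto simp: restr_def bin_seqs_def)

definition Phi :: "'a set \<Rightarrow> 'b set \<Rightarrow> ('a \<times> 'b) set \<Rightarrow> bool" where
  "Phi A B E \<longleftrightarrow>
    (\<forall>F \<in> bin_seqs \<rightarrow> A. \<exists>g \<in> UNIV \<rightarrow> B. \<forall>f::omega1 \<Rightarrow> bool.
      stationary {\<alpha>. (F (restr f \<alpha>), g \<alpha>) \<in> E})"

definition diamond :: bool where
  "diamond \<longleftrightarrow>
    (\<exists>A :: omega1 \<Rightarrow> omega1 set. (\<forall>\<alpha>. A \<alpha> \<subseteq> {..<\<alpha>}) \<and>
      (\<forall>X. stationary {\<alpha>. X \<inter> {..<\<alpha>} = A \<alpha>}))"

end

theory Submission
  imports Defs "HOL-Analysis.Abstract_Topology_2"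
begin

text \<open>
  For the invariant \<open>(\<real>, \<real>, =)\<close>, a function \<open>g\<close> as provided by \<open>\<Phi>\<close> guesses the exact
  value \<open>F (f \<restriction> \<alpha>)\<close> stationarily often. Since \<open>\<alpha>\<close> is countable, there are at most continuum
  many binary sequences of length \<open>\<alpha>\<close>, so there is an \<open>F\<close> that is injective on each set
  \<open>2\<^sup>\<alpha>\<close> (\<open>inj_on_code_seq\<close>). For such an \<open>F\<close>, guessing the real \<open>F (f \<restriction> \<alpha>)\<close> is the same as
  guessing \<open>f \<restriction> \<alpha>\<close> itself: decoding \<open>g \<alpha>\<close> at length \<open>\<alpha>\<close> gives a \<open>\<diamondsuit>\<close>-sequence.
  Conversely, a \<open>\<diamondsuit>\<close>-sequence guesses \<open>f \<restriction> \<alpha>\<close>, and applying \<open>F\<close> to the guess yields \<open>g\<close>.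
\<close>

lemma dom_restr [simp]: "dom (restr f \<alpha>) = {..<\<alpha>}"
  by (auto simp: restr_def restrict_map_def split: if_splits)

lemma restr_eq_Some_True_iff: "restr f \<alpha> x = Some True \<longleftrightarrow> x < \<alpha> \<and> f x"
  by (simp add: restr_def restrict_map_def)

lemma restr_mem_cong:
  assumes "{x. f x} \<inter> {..<\<alpha>} = A"
  shows "restr f \<alpha> = restr (\<lambda>x. x \<in> A) \<alpha>"
  using assms by (auto simp: restr_def restrict_map_def)

lemma stationary_mono: "stationary S \<Longrightarrow> S \<subseteq> T \<Longrightarrow> stationary T"
  unfolding stationary_def by blast

lemma binary_map_eqI:
  fixes s t :: "'a \<rightharpoonup> bool"
  assumes "dom s = dom t" and "{x. s x = Some True} = {x. t x = Some True}"
  shows "s = t"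
proof
  fix x
  from assms have "s x = None \<longleftrightarrow> t x = None" "s x = Some True \<longleftrightarrow> t x = Some True"
    by auto
  then show "s x = t x"
    by (cases "s x"; cases "t x") auto
qed

definition real_code :: "nat set \<Rightarrow> real" where
  "real_code = (SOME c. inj c)"

lemma inj_real_code: "inj real_code"
proof -
  have "\<exists>c :: nat set \<Rightarrow> real. inj c"
    using nat_sets_eqpoll_reals by (auto simp: eqpoll_def bij_betw_def)
  then show ?thesis
    unfolding real_code_def by (rule someI_ex)
qed

text \<open>
  The domain is transported to \<open>\<nat>\<close> by an enumeration that depends on the domain only, so codes
  are comparable between sequences of the same length; sequences of different lengths may share
  a code, which is harmless because the length \<open>\<alpha>\<close> is known when \<open>g \<alpha>\<close> is decoded.
\<close>

definition code_seq :: "('a \<rightharpoonup> bool) \<Rightarrow> real" where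
  "code_seq s = real_code (to_nat_on (dom s) ` {x. s x = Some True})"

lemma inj_on_code_seq:
  assumes "countable D"
  shows "inj_on code_seq {s. dom s = D}"
proof (rule inj_onI)
  fix s t :: "'a \<rightharpoonup> bool"
  assume s: "s \<in> {s. dom s = D}" and t: "t \<in> {s. dom s = D}" and eq: "code_seq s = code_seq t"
  have "to_nat_on D ` {x. s x = Some True} = to_nat_on D ` {x. t x = Some True}"
    using eq s t inj_real_code by (simp add: code_seq_def inj_eq)
  moreover have "{x. s x = Some True} \<subseteq> D" "{x. t x = Some True} \<subseteq> D"
    using s t by auto
  ultimately have "{x. s x = Some True} = {x. t x = Some True}"
    using inj_on_to_nat_on[OF assms] by (simp add: inj_on_image_eq_iff)
  then show "s = t"
    using s t by (simp add: binary_map_eqI)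
qed

text \<open>
  Where the \<open>\<diamondsuit>\<close>-guess at \<open>\<alpha>\<close> is right, applying \<open>F\<close> to it gives \<open>F (f \<restriction> \<alpha>)\<close>, so \<open>g \<alpha>\<close> only
  has to answer a known challenge \<open>a \<in> A\<close>; the function \<open>h\<close> supplies such answers.
\<close>

lemma diamond_imp_Phi:
  assumes "diamond" and h: "\<And>a. a \<in> A \<Longrightarrow> h a \<in> B \<and> (a, h a) \<in> E"
  shows "Phi A B E"
  unfolding Phi_def
proof
  fix F :: "(omega1 \<rightharpoonup> bool) \<Rightarrow> 'a"
  assume F: "F \<in> bin_seqs \<rightarrow> A"
  then have F_restr: "F (restr f \<alpha>) \<in> A" for f \<alpha>
    using restr_in_bin_seqs by blast
  obtain D where D: "\<And>X. stationary {\<alpha>. X \<inter> {..<\<alpha>} = D \<alpha>}"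
    using \<open>diamond\<close> unfolding diamond_def by blast
  define g where "g \<alpha> = h (F (restr (\<lambda>x. x \<in> D \<alpha>) \<alpha>))" for \<alpha>
  have "stationary {\<alpha>. (F (restr f \<alpha>), g \<alpha>) \<in> E}" for f
  proof (rule stationary_mono[OF D], rule subsetI)
    fix \<alpha>
    assume "\<alpha> \<in> {\<alpha>. {x. f x} \<inter> {..<\<alpha>} = D \<alpha>}"
    then have "g \<alpha> = h (F (restr f \<alpha>))"
      unfolding g_def by (simp only: mem_Collect_eq restr_mem_cong[of f \<alpha> "D \<alpha>"])
    then show "\<alpha> \<in> {\<alpha>. (F (restr f \<alpha>), g \<alpha>) \<in> E}"
      using h[OF F_restr] by simp
  qed
  moreover have "g \<in> UNIV \<rightarrow> B"
    using F_restr h by (simp add: g_def)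
  ultimately show "\<exists>g \<in> UNIV \<rightarrow> B. \<forall>f. stationary {\<alpha>. (F (restr f \<alpha>), g \<alpha>) \<in> E}"
    by blast
qed

lemma Phi_real_eq_imp_diamond:
  assumes "Phi (UNIV :: real set) (UNIV :: real set) {(x, y). x = y}"
  shows "diamond"
proof -
  have "code_seq \<in> bin_seqs \<rightarrow> (UNIV :: real set)"
    by simp
  from assms[unfolded Phi_def, rule_format, OF this] obtain g
    where g: "\<And>f. stationary {\<alpha>. code_seq (restr f \<alpha>) = g \<alpha>}"
    by auto
  define D where
    "D \<alpha> = {x. \<exists>s. dom s = {..<\<alpha>} \<and> code_seq s = g \<alpha> \<and> s x = Some True}" for \<alpha>
  have "D \<alpha> \<subseteq> {..<\<alpha>}" for \<alpha>
    unfolding D_def by blast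
  moreover have "stationary {\<alpha>. X \<inter> {..<\<alpha>} = D \<alpha>}" for X
  proof (rule stationary_mono[OF g], rule subsetI)
    let ?f = "\<lambda>x. x \<in> X"
    fix \<alpha>
    assume "\<alpha> \<in> {\<alpha>. code_seq (restr ?f \<alpha>) = g \<alpha>}"
    then have code: "code_seq (restr ?f \<alpha>) = g \<alpha>"
      by simp
    \<comment> \<open>The decoding at \<open>\<alpha>\<close> is unambiguous: \<open>restr ?f \<alpha>\<close> is the only sequence of length \<open>\<alpha>\<close> with code \<open>g \<alpha>\<close>.\<close>
    have "s = restr ?f \<alpha>" if "dom s = {..<\<alpha>}" "code_seq s = g \<alpha>" for s
      by (rule inj_onD[OF inj_on_code_seq[OF countable_lessThan_omega1[of \<alpha>]]])
        (simp_all only: that code dom_restr mem_Collect_eq)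
    then have unique: "dom s = {..<\<alpha>} \<and> code_seq s = g \<alpha> \<longleftrightarrow> s = restr ?f \<alpha>" for s
      using code dom_restr[of ?f \<alpha>] by blast
    have "D \<alpha> = {x. restr ?f \<alpha> x = Some True}"
      by (simp only: D_def conj_assoc[symmetric] unique simp_thms)
    then show "\<alpha> \<in> {\<alpha>. X \<inter> {..<\<alpha>} = D \<alpha>}"
      by (auto simp: restr_eq_Some_True_iff)
  qed
  ultimately show ?thesis
    unfolding diamond_def by blast
qed

theorem proposition2p6:
  shows "Phi (UNIV :: real set) (UNIV :: real set) {(x, y). x = y} \<longleftrightarrow> diamond"
proof
  show "diamond" if "Phi (UNIV :: real set) (UNIV :: real set) {(x, y). x = y}"
    using that by (rule Phi_real_eq_imp_diamond)
  show "Phi (UNIV :: real set) (UNIV :: real set) {(x, y). x = y}" if "diamond"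
    by (rule diamond_imp_Phi[OF that, where h = "\<lambda>x. x"]) simp
qed

end
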